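(* For every $n\in\mathbb N$, $$\mathcal{CS}_+^n\subseteq \mathcal{CS}_{\infty+}^n\subseteq \mathrm{cl}(\mathcal{CS}_{\infty+}^n)=\mathrm{cl}(\mathcal{CS}_+^n).$$
   Context: $\mathcal S^d$ denotes the real symmetric $d\times d$ matrices with trace inner product $\langle X,Y\rangle=\mathrm{Tr}(XY)$, and $\mathcal S^d_+$ the positive semidefinite ones. $\mathcal{CS}_+^n$ is the set of $A\in\mathcal S^n$ for which there exist $d\ge1$ and $X_1,\dots,X_n\in\mathcal S^d_+$ with $A_{ij}=\langle X_i,X_j\rangle$ for all $i,j$. $\mathcal S^{\mathbb N}$ denotes the set of infinite real symmetric matrices $X=(X_{ij})_{i,j\ge1}$ with $\sum_{i,j\ge1}X_{ij}^2<\infty$; it is a Hilbert space with inner product $\langle X,Y\rangle=\sum_{i,j\ge 1}X_{ij}Y_{ij}$. $\mathcal S^{\mathbb N}_+$ is the set of $X\in\mathcal S^{\mathbb N}$ all of whose finite principal submatrices are positive semidefinite. $\mathcal{CS}_{\infty+}^n$ is the set of $A\in\mathcal S^n$ for which there exist $X_1,\dots,X_n\in\mathcal S^{\mathbb N}_+$ with $A_{ij}=\langle X_i,X_j\rangle$ for all $i,j$. $\mathrm{cl}$ denotes topological closure in $\mathcal S^n$. *)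

theory Defs
  imports
    "HOL-Analysis.Analysis"
    "Jordan_Normal_Form.Matrix"
    "Jordan_Normal_Form.DL_Missing_Sublist"
begin

text \<open>
  The outer size \<open>n\<close> is the cardinality of a finite index type \<open>'n\<close>, so that
  \<^typ>\<open>real ^ 'n ^ 'n\<close> carries its usual topology.  The inner size \<open>d\<close> is
  existentially quantified, so the factors are matrices of type \<^typ>\<open>real mat\<close>.
\<close>

definition sym_matrices :: "(real ^ 'n ^ 'n) set" where
  "sym_matrices = {A. Finite_Cartesian_Product.transpose A = A}"

definition sym_mats :: "nat \<Rightarrow> real mat set" where
  "sym_mats d = {X \<in> carrier_mat d d. transpose_mat X = X}"

definition psd_mats :: "nat \<Rightarrow> real mat set" where
  "psd_mats d =
     {X \<in> sym_mats d. \<forall>v \<in> carrier_vec d. scalar_prod v (mult_mat_vec X v) \<ge> 0}"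

definition mat_trace :: "real mat \<Rightarrow> real" where
  "mat_trace X = (\<Sum>i<dim_row X. X $$ (i, i))"

definition trace_inner :: "real mat \<Rightarrow> real mat \<Rightarrow> real" where
  "trace_inner X Y = mat_trace (X * Y)"

definition CS_plus :: "(real ^ 'n ^ 'n) set" where
  "CS_plus = {A \<in> sym_matrices. \<exists>d \<ge> 1. \<exists>X :: 'n \<Rightarrow> real mat.
     (\<forall>i. X i \<in> psd_mats d) \<and>
     (\<forall>i j. vec_nth (vec_nth A i) j = trace_inner (X i) (X j))}"

text \<open>Infinite matrices are indexed from 0.\<close>

type_synonym inf_mat = "nat \<Rightarrow> nat \<Rightarrow> real"

definition inf_sym_mats :: "inf_mat set" where
  "inf_sym_mats =
     {X. (\<forall>i j. X i j = X j i) \<and> (\<lambda>(i, j). (X i j)\<^sup>2) summable_on UNIV}"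

definition inf_inner :: "inf_mat \<Rightarrow> inf_mat \<Rightarrow> real" where
  "inf_inner X Y = (\<Sum>\<^sub>\<infinity>(i, j)\<in>UNIV. X i j * Y i j)"

text \<open>For finite \<open>I\<close>, \<^term>\<open>pick I k\<close> is the element of \<open>I\<close> with exactly \<open>k\<close>
  smaller elements in \<open>I\<close>.\<close>

definition principal_submatrix :: "inf_mat \<Rightarrow> nat set \<Rightarrow> real mat" where
  "principal_submatrix X I =
     Matrix.mat (card I) (card I) (\<lambda>(k, l). X (pick I k) (pick I l))"

definition inf_psd_mats :: "inf_mat set" where
  "inf_psd_mats =
     {X \<in> inf_sym_mats. \<forall>I. finite I \<longrightarrow> principal_submatrix X I \<in> psd_mats (card I)}"

definition CS_inf_plus :: "(real ^ 'n ^ 'n) set" where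
  "CS_inf_plus = {A \<in> sym_matrices. \<exists>X :: 'n \<Rightarrow> inf_mat.
     (\<forall>i. X i \<in> inf_psd_mats) \<and>
     (\<forall>i j. vec_nth (vec_nth A i) j = inf_inner (X i) (X j))}"

text \<open>The closure is taken in the subspace of symmetric matrices.\<close>

definition cl_sym :: "(real ^ 'n ^ 'n) set \<Rightarrow> (real ^ 'n ^ 'n) set" where
  "cl_sym S = top_of_set sym_matrices closure_of S"

end

theory Submission
  imports Defs
begin

text \<open>
  Padding a finite factorisation with zeros keeps it positive semidefinite and preserves all inner
  products.  Conversely, the leading \<open>N \<times> N\<close> blocks of square-summable factors are
  positive semidefinite, and since products of square-summable families are summable, their trace
  inner products converge to those of the infinite matrices as \<open>N\<close> grows.
\<close>

text \<open>The test vectors become arbitrary functions \<open>w\<close> on the naturals, which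
  removes dimension side conditions from later arguments. Nothing is lost: only the values of
  \<open>w\<close> below \<open>d\<close> enter the sum.\<close>

lemma mat_in_psd_mats_iff:
  "Matrix.mat d d (\<lambda>(i, j). f i j) \<in> psd_mats d \<longleftrightarrow>
     (\<forall>i<d. \<forall>j<d. f i j = f j i) \<and> (\<forall>w. 0 \<le> (\<Sum>i<d. \<Sum>j<d. w i * w j * f i j))"
  (is "?M \<in> _ \<longleftrightarrow> _")
proof -
  have sym: "transpose_mat ?M = ?M \<longleftrightarrow> (\<forall>i<d. \<forall>j<d. f i j = f j i)"
    by (auto simp: mat_eq_iff)
  have form: "scalar_prod v (mult_mat_vec ?M v)
      = (\<Sum>i<d. \<Sum>j<d. vec_index v i * vec_index v j * f i j)"
    if "v \<in> carrier_vec d" for v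
    using that
    by (auto simp: scalar_prod_def sum_distrib_left lessThan_atLeast0 mult_ac intro!: sum.cong)
  have "(\<forall>v \<in> carrier_vec d. 0 \<le> scalar_prod v (mult_mat_vec ?M v)) \<longleftrightarrow>
      (\<forall>w. 0 \<le> (\<Sum>i<d. \<Sum>j<d. w i * w j * f i j))" (is "?L \<longleftrightarrow> ?R")
  proof
    assume ?L
    show ?R
    proof
      fix w
      have "0 \<le> (\<Sum>i<d. \<Sum>j<d. vec_index (Matrix.vec d w) i * vec_index (Matrix.vec d w) j * f i j)"
        using \<open>?L\<close> form[of "Matrix.vec d w"] by (metis vec_carrier)
      also have "\<dots> = (\<Sum>i<d. \<Sum>j<d. w i * w j * f i j)"
        by (intro sum.cong) auto
      finally show "0 \<le> (\<Sum>i<d. \<Sum>j<d. w i * w j * f i j)" .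
    qed
  qed (simp add: form)
  then show ?thesis
    by (simp add: psd_mats_def sym_mats_def sym)
qed

text \<open>Since \<open>pick I\<close> enumerates \<open>I\<close> bijectively, reindexing removes
  it, and semidefiniteness can be tested by sums over \<open>I\<close> itself.\<close>

lemma principal_submatrix_in_psd_mats_iff:
  assumes "finite I"
  shows "principal_submatrix X I \<in> psd_mats (card I) \<longleftrightarrow>
    (\<forall>i\<in>I. \<forall>j\<in>I. X i j = X j i) \<and> (\<forall>w. 0 \<le> (\<Sum>i\<in>I. \<Sum>j\<in>I. w i * w j * X i j))"
proof -
  let ?p = "pick I" and ?c = "card I"
  have inj: "inj_on ?p {..<?c}"
    by (rule inj_onI) (metis lessThan_iff nat_neq_iff pick_mono_le)
  have "?p ` {..<?c} \<subseteq> I"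
    using pick_in_set_le by auto
  with assms inj have bij: "bij_betw ?p {..<?c} I"
    by (metis bij_betw_def card_image card_lessThan card_subset_eq)
  have re: "(\<Sum>k<?c. \<Sum>l<?c. h (?p k) (?p l)) = (\<Sum>i\<in>I. \<Sum>j\<in>I. h i j)"
    for h :: "nat \<Rightarrow> nat \<Rightarrow> real"
    by (simp add: sum.reindex_bij_betw[OF bij, of "h _"] sum.reindex_bij_betw[OF bij, of "\<lambda>i. \<Sum>j\<in>I. h i j"])
  have img: "?p ` {..<?c} = I"
    using bij by (simp add: bij_betw_def)
  have "(\<forall>k<?c. \<forall>l<?c. X (?p k) (?p l) = X (?p l) (?p k)) \<longleftrightarrow> (\<forall>i\<in>I. \<forall>j\<in>I. X i j = X j i)"
    by (subst (3 4) img[symmetric]) auto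
  moreover have "(\<forall>w. 0 \<le> (\<Sum>k<?c. \<Sum>l<?c. w k * w l * X (?p k) (?p l))) \<longleftrightarrow>
      (\<forall>w. 0 \<le> (\<Sum>i\<in>I. \<Sum>j\<in>I. w i * w j * X i j))" (is "?L \<longleftrightarrow> ?R")
  proof
    assume ?L
    show ?R
    proof
      fix w
      show "0 \<le> (\<Sum>i\<in>I. \<Sum>j\<in>I. w i * w j * X i j)"
        using \<open>?L\<close>[rule_format, of "w \<circ> ?p"] re[of "\<lambda>i j. w i * w j * X i j"] by simp
    qed
  next
    assume ?R
    show ?L
    proof
      fix w
      \<comment> \<open>Weights on positions are carried to weights on \<open>I\<close> along the
        inverse of the enumeration; injectivity then gives back \<open>w k\<close>.\<close>
      have "0 \<le> (\<Sum>k<?c. \<Sum>l<?c. w (inv_into {..<?c} ?p (?p k)) * w (inv_into {..<?c} ?p (?p l)) * X (?p k) (?p l))"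
        using \<open>?R\<close>[rule_format, of "\<lambda>i. w (inv_into {..<?c} ?p i)"] by (subst re)
      also have "\<dots> = (\<Sum>k<?c. \<Sum>l<?c. w k * w l * X (?p k) (?p l))"
        by (intro sum.cong) (auto simp: inv_into_f_f[OF inj])
      finally show "0 \<le> (\<Sum>k<?c. \<Sum>l<?c. w k * w l * X (?p k) (?p l))" .
    qed
  qed
  ultimately show ?thesis
    unfolding principal_submatrix_def mat_in_psd_mats_iff by simp
qed

text \<open>Symmetry of \<open>Y\<close> turns the trace of \<open>X * Y\<close> into a sum of
  entrywise products, the shape that \<open>inf_inner\<close> has.\<close>

lemma trace_inner_psd_mats:
  assumes "X \<in> psd_mats d" "Y \<in> psd_mats d"
  shows "trace_inner X Y = (\<Sum>(i, j)\<in>{..<d} \<times> {..<d}. X $$ (i, j) * Y $$ (i, j))"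
proof -
  have X: "X \<in> carrier_mat d d" and Y: "Y \<in> carrier_mat d d" and "transpose_mat Y = Y"
    using assms by (auto simp: psd_mats_def sym_mats_def)
  then have "Y $$ (j, i) = Y $$ (i, j)" if "i < d" "j < d" for i j
    using that by (metis carrier_matD index_transpose_mat(1))
  then show ?thesis
    using X Y unfolding trace_inner_def mat_trace_def sum.cartesian_product[symmetric]
    by (auto simp: scalar_prod_def lessThan_atLeast0 intro!: sum.cong)
qed

definition pad_mat :: "real mat \<Rightarrow> inf_mat" where
  "pad_mat X i j = (if i < dim_row X \<and> j < dim_col X then X $$ (i, j) else 0)"

text \<open>Square summability is clear because only finitely many entries are nonzero. Each finite
  quadratic form of the padded matrix is a value of the quadratic form of \<open>X\<close>.\<close>

lemma pad_mat_in_inf_psd_mats: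
  assumes "X \<in> psd_mats d"
  shows "pad_mat X \<in> inf_psd_mats"
proof -
  have X: "X = Matrix.mat d d (\<lambda>(i, j). pad_mat X i j)" and dim: "dim_row X = d" "dim_col X = d"
    using assms by (auto simp: psd_mats_def sym_mats_def pad_mat_def)
  have psd: "(\<forall>i<d. \<forall>j<d. pad_mat X i j = pad_mat X j i)"
      "\<And>w. 0 \<le> (\<Sum>i<d. \<Sum>j<d. w i * w j * pad_mat X i j)"
    using assms X mat_in_psd_mats_iff[of d "pad_mat X"] by metis+
  have outside: "pad_mat X i j = 0" if "\<not> (i < d \<and> j < d)" for i j
    using that dim by (auto simp: pad_mat_def)
  have sym: "pad_mat X i j = pad_mat X j i" for i j
    using psd(1) outside by metis
  have "(\<lambda>(i, j). (pad_mat X i j)\<^sup>2) summable_on UNIV \<longleftrightarrow>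
      (\<lambda>(i, j). (pad_mat X i j)\<^sup>2) summable_on ({..<d} \<times> {..<d})"
    by (intro summable_on_cong_neutral) (auto intro: outside)
  then have "pad_mat X \<in> inf_sym_mats"
    using sym by (auto simp: inf_sym_mats_def)
  moreover have "0 \<le> (\<Sum>i\<in>I. \<Sum>j\<in>I. w i * w j * pad_mat X i j)" if "finite I" for I w
  proof -
    \<comment> \<open>Cutting \<open>w\<close> off outside \<open>I\<close> lets both double sums be
      compared: \<open>u\<close> kills indices outside \<open>I\<close>, the padding kills indices
      from \<open>d\<close> on.\<close>
    define u where "u i = (if i \<in> I then w i else 0)" for i
    have "(\<Sum>(i, j)\<in>I \<times> I. w i * w j * pad_mat X i j)
        = (\<Sum>(i, j)\<in>{..<d} \<times> {..<d}. u i * u j * pad_mat X i j)"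
      using that by (intro sum.mono_neutral_cong) (auto simp: u_def split: if_splits intro: outside)
    then show ?thesis
      using psd(2)[of u] by (simp add: sum.cartesian_product)
  qed
  ultimately show ?thesis
    by (auto simp: inf_psd_mats_def principal_submatrix_in_psd_mats_iff intro: sym)
qed

lemma inf_inner_pad_mat:
  assumes "X \<in> psd_mats d" "Y \<in> psd_mats d"
  shows "inf_inner (pad_mat X) (pad_mat Y) = trace_inner X Y"
proof -
  have dim: "dim_row X = d" "dim_col X = d" "dim_row Y = d" "dim_col Y = d"
    using assms by (auto simp: psd_mats_def sym_mats_def)
  have "inf_inner (pad_mat X) (pad_mat Y)
      = (\<Sum>\<^sub>\<infinity>(i, j)\<in>{..<d} \<times> {..<d}. X $$ (i, j) * Y $$ (i, j))"
    unfolding inf_inner_def by (intro infsum_cong_neutral) (auto simp: pad_mat_def dim split: if_splits)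
  then show ?thesis
    using assms by (simp add: trace_inner_psd_mats[where d = d])
qed

lemma CS_plus_subset_CS_inf_plus: "CS_plus \<subseteq> CS_inf_plus"
proof
  fix A :: "real ^ 'n ^ 'n"
  assume "A \<in> CS_plus"
  then obtain d X where "A \<in> sym_matrices" "\<forall>i. X i \<in> psd_mats d"
      "\<forall>i j. vec_nth (vec_nth A i) j = trace_inner (X i) (X j)"
    by (auto simp: CS_plus_def)
  then show "A \<in> CS_inf_plus"
    unfolding CS_inf_plus_def
    by (auto simp: inf_inner_pad_mat[where d = d] intro!: exI[of _ "pad_mat \<circ> X"]
        pad_mat_in_inf_psd_mats[where d = d])
qed

abbreviation truncate :: "inf_mat \<Rightarrow> nat \<Rightarrow> real mat" where
  "truncate X N \<equiv> Matrix.mat N N (\<lambda>(i, j). X i j)"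

text \<open>This is the principal submatrix for \<open>{..<N}\<close>. Both semidefiniteness
  criteria reduce to the same condition, so \<open>pick {..<N}\<close> need not be computed.\<close>

lemma truncate_in_psd_mats:
  assumes "X \<in> inf_psd_mats"
  shows "truncate X N \<in> psd_mats N"
proof -
  have "principal_submatrix X {..<N} \<in> psd_mats (card {..<N})"
    using assms unfolding inf_psd_mats_def by blast
  then show ?thesis
    unfolding mat_in_psd_mats_iff principal_submatrix_in_psd_mats_iff[OF finite_lessThan] by auto
qed

text \<open>The products are dominated through |xy| \<le> x^2 + y^2.\<close>

lemma inf_inner_summable:
  assumes "X \<in> inf_sym_mats" "Y \<in> inf_sym_mats"
  shows "(\<lambda>(i, j). X i j * Y i j) summable_on UNIV"
proof -
  have "(\<lambda>p. (case p of (i, j) \<Rightarrow> (X i j)\<^sup>2) + (case p of (i, j) \<Rightarrow> (Y i j)\<^sup>2)) summable_on UNIV"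
    using assms unfolding inf_sym_mats_def by (intro summable_on_add) auto
  then have "(\<lambda>p. norm (case p of (i, j) \<Rightarrow> X i j * Y i j)) summable_on UNIV"
  proof (rule Infinite_Sum.abs_summable_on_comparison_test')
    fix p :: "nat \<times> nat"
    have "\<bar>x * y\<bar> \<le> x\<^sup>2 + y\<^sup>2" for x y :: real
    proof -
      have "2 * \<bar>x * y\<bar> \<le> x\<^sup>2 + y\<^sup>2"
        using sum_squares_bound[of "\<bar>x\<bar>" "\<bar>y\<bar>"] by (simp add: abs_mult)
      then show ?thesis
        using abs_ge_zero[of "x * y"] by linarith
    qed
    then show "norm (case p of (i, j) \<Rightarrow> X i j * Y i j)
        \<le> (case p of (i, j) \<Rightarrow> (X i j)\<^sup>2) + (case p of (i, j) \<Rightarrow> (Y i j)\<^sup>2)"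
      by (simp add: case_prod_beta)
  qed
  then show ?thesis
    by (rule abs_summable_summable)
qed

text \<open>Every finite set of index pairs lies in some square, so an unconditional sum may be
  computed along growing squares.\<close>

lemma filterlim_squares_finite_subsets_at_top:
  "filterlim (\<lambda>N::nat. {..<N} \<times> {..<N}) (finite_subsets_at_top UNIV) sequentially"
  unfolding filterlim_finite_subsets_at_top
proof (intro allI impI)
  fix F :: "(nat \<times> nat) set"
  assume "finite F \<and> F \<subseteq> UNIV"
  then have "finite (fst ` F \<union> snd ` F)"
    by simp
  then obtain M where "fst ` F \<union> snd ` F \<subseteq> {..<M}"
    using finite_nat_iff_bounded by blast
  then have "F \<subseteq> {..<N} \<times> {..<N}" if "N \<ge> M" for N
    using that by fastforce
  then show "\<forall>\<^sub>F N in sequentially. finite ({..<N} \<times> {..<N}) \<and> F \<subseteq> {..<N} \<times> {..<N} \<and> {..<N} \<times> {..<N} \<subseteq> UNIV"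
    by (auto simp: eventually_sequentially)
qed

lemma trace_inner_truncate_tendsto:
  assumes "X \<in> inf_psd_mats" "Y \<in> inf_psd_mats"
  shows "(\<lambda>N. trace_inner (truncate X N) (truncate Y N)) \<longlonglongrightarrow> inf_inner X Y"
proof -
  \<comment> \<open>Summability ensures that \<open>inf_inner X Y\<close> is the true sum and not
    the default value 0 of an infinite sum.\<close>
  have "((\<lambda>(i, j). X i j * Y i j) has_sum inf_inner X Y) UNIV"
    unfolding inf_inner_def
    using assms by (intro has_sum_infsum inf_inner_summable) (auto simp: inf_psd_mats_def)
  then have "(\<lambda>N. \<Sum>(i, j)\<in>{..<N} \<times> {..<N}. X i j * Y i j) \<longlonglongrightarrow> inf_inner X Y"
    unfolding has_sum_def by (rule filterlim_compose[OF _ filterlim_squares_finite_subsets_at_top])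
  moreover have "trace_inner (truncate X N) (truncate Y N)
      = (\<Sum>(i, j)\<in>{..<N} \<times> {..<N}. X i j * Y i j)" for N
    using assms by (auto simp: trace_inner_psd_mats[where d = N] truncate_in_psd_mats intro!: sum.cong)
  ultimately show ?thesis
    by simp
qed

text \<open>This passes from the relative closure to the ambient one, where limits of sequences are
  available.\<close>

lemma cl_sym_eq: "S \<subseteq> sym_matrices \<Longrightarrow> cl_sym S = sym_matrices \<inter> closure S"
  by (simp add: cl_sym_def closure_of_subtopology Int_absorb1)

lemma CS_inf_plus_subset_cl_CS_plus: "CS_inf_plus \<subseteq> cl_sym CS_plus"
proof
  fix A :: "real ^ 'n ^ 'n"
  assume "A \<in> CS_inf_plus"
  then obtain X where A: "A \<in> sym_matrices" and X: "\<And>i. X i \<in> inf_psd_mats"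
      and AX: "\<And>i j. vec_nth (vec_nth A i) j = inf_inner (X i) (X j)"
    by (auto simp: CS_inf_plus_def)
  \<comment> \<open>\<open>B N\<close> is the Gram matrix of the truncated factors. The size is
    \<open>Suc N\<close> because \<open>CS_plus\<close> demands dimension at least 1.\<close>
  define B :: "nat \<Rightarrow> real ^ 'n ^ 'n" where
    "B N = (\<chi> i j. trace_inner (truncate (X i) (Suc N)) (truncate (X j) (Suc N)))" for N
  have "B N \<in> CS_plus" for N
  proof -
    have "B N \<in> sym_matrices"
      by (simp add: sym_matrices_def B_def vec_eq_iff Finite_Cartesian_Product.transpose_def
          trace_inner_psd_mats[where d = "Suc N"] truncate_in_psd_mats X mult.commute)
    moreover have "\<forall>i. truncate (X i) (Suc N) \<in> psd_mats (Suc N)"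
      by (simp add: truncate_in_psd_mats X)
    ultimately show ?thesis
      unfolding CS_plus_def
      by (auto simp: B_def intro!: exI[of _ "Suc N"] exI[of _ "\<lambda>i. truncate (X i) (Suc N)"])
  qed
  moreover have "B \<longlonglongrightarrow> A"
  \<comment> \<open>The outer index type is finite, so entrywise convergence suffices;
    \<open>LIMSEQ_Suc\<close> accounts for the shifted size.\<close>
  proof (intro vec_tendstoI)
    fix i j
    show "(\<lambda>N. vec_nth (vec_nth (B N) i) j) \<longlonglongrightarrow> vec_nth (vec_nth A i) j"
      using LIMSEQ_Suc[OF trace_inner_truncate_tendsto[OF X X, of i j]] by (simp add: B_def AX)
  qed
  ultimately have "A \<in> closure CS_plus"
    unfolding closure_sequential by blast
  then show "A \<in> cl_sym CS_plus"
    using A by (subst cl_sym_eq) (auto simp: CS_plus_def)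
qed

theorem theorem3p3:
  shows "(CS_plus :: (real ^ 'n ^ 'n) set) \<subseteq> CS_inf_plus
    \<and> (CS_inf_plus :: (real ^ 'n ^ 'n) set) \<subseteq> cl_sym CS_inf_plus
    \<and> cl_sym (CS_inf_plus :: (real ^ 'n ^ 'n) set) = cl_sym CS_plus"
proof (intro conjI subset_antisym)
  show "CS_inf_plus \<subseteq> cl_sym (CS_inf_plus :: (real ^ 'n ^ 'n) set)"
    unfolding cl_sym_def by (rule closure_of_subset) (auto simp: CS_inf_plus_def)
  \<comment> \<open>The right-hand side is closed in the symmetric matrices and contains
    \<open>CS_inf_plus\<close>, hence also its closure.\<close>
  show "cl_sym CS_inf_plus \<subseteq> cl_sym (CS_plus :: (real ^ 'n ^ 'n) set)"
    using CS_inf_plus_subset_cl_CS_plus unfolding cl_sym_def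
    by (intro closure_of_minimal) auto
  show "cl_sym CS_plus \<subseteq> cl_sym (CS_inf_plus :: (real ^ 'n ^ 'n) set)"
    unfolding cl_sym_def by (intro closure_of_mono CS_plus_subset_CS_inf_plus)
qed (rule CS_plus_subset_CS_inf_plus)

end
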